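(* Let $(X,\|\cdot\|)$ be an infinite dimensional real Banach space, and let $\{l_k\}_{k=1}^\infty$ be a sequence in the dual space $X^{\ast}$ with $\|l_k\|_{X^{\ast}}=1$ for all $k\in\mathbb{N}$ such that, for $x\in X$, one has $x=0$ if and only if $l_k(x)=0$ for all $k\in\mathbb{N}$. (That is, $X$ is weakly separable, as witnessed by the normalized sequence $\{l_k\}$.) Then the map $$x\mapsto \exp\Bigg(-\frac{1}{\sum_{k=1}^{\infty}\frac{l_k(x)^2}{2^k}}\Bigg)\cdot x$$ from $(X,\|\cdot\|)$ to itself is a non-open $C^1$ map with a unique critical point, located at the origin.
   Context: Convention: $\frac{1}{0}=\infty$ and $\exp(-\infty)=0$, so the map sends $0$ to $0$. An infinite dimensional real Banach space $X$ is called weakly separable if there is a sequence of continuous linear functionals $\{l_k\}_{k=1}^\infty$ on $X$ such that $x=0$ if and only if $l_k(x)=0$ for all $k\in\mathbb{N}$. Let $X,Y$ be real Banach spaces and $F:X\to Y$ a map that is Fréchet differentiable at $x\in X$ with derivative $J_F(x)\in B(X,Y)$, where $B(X,Y)$ is the space of bounded linear operators from $X$ to $Y$. The point $x$ is a regular point of $F$ if $J_F(x)$ has an inverse in $B(Y,X)$, and a critical point of $F$ otherwise. $F$ is $C^1$ if it is Fréchet differentiable everywhere and $x\mapsto J_F(x)$ is continuous from $X$ to $B(X,Y)$ with the operator norm. A map is open if it maps open sets to open sets. *)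

theory Defs
  imports "HOL-Analysis.Analysis"
begin

definition infinite_dimensional :: "'a::real_vector itself \<Rightarrow> bool" where
  "infinite_dimensional _ \<longleftrightarrow> \<not> (\<exists>B :: 'a set. finite B \<and> span B = UNIV)"

definition C1_map :: "('a::real_normed_vector \<Rightarrow> 'b::real_normed_vector) \<Rightarrow> bool" where
  "C1_map F \<longleftrightarrow>
    (\<exists>J :: 'a \<Rightarrow> 'a \<Rightarrow>\<^sub>L 'b.
      (\<forall>x. (F has_derivative blinfun_apply (J x)) (at x)) \<and> continuous_on UNIV J)"

definition has_bounded_inverse :: "('a::real_normed_vector \<Rightarrow>\<^sub>L 'b::real_normed_vector) \<Rightarrow> bool" where
  "has_bounded_inverse A \<longleftrightarrow>
    (\<exists>B :: 'b \<Rightarrow>\<^sub>L 'a. B o\<^sub>L A = id_blinfun \<and> A o\<^sub>L B = id_blinfun)"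

definition regular_point :: "('a::real_normed_vector \<Rightarrow> 'b::real_normed_vector) \<Rightarrow> 'a \<Rightarrow> bool" where
  "regular_point F x \<longleftrightarrow>
    (\<exists>A :: 'a \<Rightarrow>\<^sub>L 'b. (F has_derivative blinfun_apply A) (at x) \<and> has_bounded_inverse A)"

definition critical_point :: "('a::real_normed_vector \<Rightarrow> 'b::real_normed_vector) \<Rightarrow> 'a \<Rightarrow> bool" where
  "critical_point F x \<longleftrightarrow> F differentiable (at x) \<and> \<not> regular_point F x"

(* The conventions 1/0 = \<infinity> and exp (-\<infinity>) = 0 have to be built in by hand,
   because 1/0 = 0 in HOL. *)
definition exp_neg_recip :: "real \<Rightarrow> real" where
  "exp_neg_recip s = (if s = 0 then 0 else exp (- (1 / s)))"

(* The sequence l is indexed from 1; the value l 0 is never used. *)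
definition weighted_square_sum :: "(nat \<Rightarrow> 'a::real_normed_vector \<Rightarrow>\<^sub>L real) \<Rightarrow> 'a \<Rightarrow> real" where
  "weighted_square_sum l x = (\<Sum>k. (blinfun_apply (l (Suc k)) x)\<^sup>2 / 2 ^ Suc k)"

definition flat_map :: "(nat \<Rightarrow> 'a::real_normed_vector \<Rightarrow>\<^sub>L real) \<Rightarrow> 'a \<Rightarrow> 'a" where
  "flat_map l x = exp_neg_recip (weighted_square_sum l x) *\<^sub>R x"

end

theory Submission
  imports Defs "HOL-Real_Asymp.Real_Asymp"
begin

text \<open>
  Write \<open>Q\<close> for the weighted square sum and \<open>g s = exp (- 1 / s)\<close>. Away from the origin the
  derivative of \<open>x \<mapsto> g (Q x) x\<close> is a multiple of the identity plus a rank-one operator, and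
  Euler's identity \<open>Q' x x = 2 Q x\<close> makes its Sherman--Morrison determinant
  \<open>g (Q x) (1 + 2 / Q x)\<close> positive; at the origin the flatness of \<open>g\<close> makes the derivative vanish.
  The map preserves rays, and on the ray through a unit vector \<open>e\<close> it sends the unit ball into the
  ball of radius \<open>g (Q e)\<close>. In infinite dimension a unit vector can be annihilated by the first
  \<open>n\<close> functionals, so \<open>Q e \<le> 1 / 2 ^ n\<close>, and the image of the unit ball contains no
  neighbourhood of the origin.
\<close>

section \<open>Common kernels of finitely many functionals\<close>

text \<open>Each further functional lowers the dimension of the common kernel by at most one, and
  adding one vector to \<open>B\<close> makes up for that.\<close>

lemma finite_span_with_kernels:
  fixes m :: "nat \<Rightarrow> 'a::real_vector \<Rightarrow> real"
  assumes lin: "\<And>k. linear (m k)"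
  shows "\<exists>B. finite B \<and> span (B \<union> {x. \<forall>k<n. m k x = 0}) = UNIV"
proof (induction n)
  case 0
  show ?case by (intro exI[of _ "{}"]) simp
next
  case (Suc n)
  define K where "K n = {x. \<forall>k<n. m k x = 0}" for n
  from Suc obtain B where B: "finite B" "span (B \<union> K n) = UNIV"
    unfolding K_def by blast
  show ?case
  proof (cases "K n \<subseteq> K (Suc n)")
    case True
    then have "span (B \<union> K (Suc n)) = UNIV"
      using B(2) span_mono[of "B \<union> K n" "B \<union> K (Suc n)"] by blast
    then show ?thesis using B(1) unfolding K_def by blast
  next
    case False
    then obtain v where v: "v \<in> K n" "m n v \<noteq> 0"
      unfolding K_def by (auto simp: less_Suc_eq)
    let ?S = "span (insert v B \<union> K (Suc n))"
    have "K n \<subseteq> ?S"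
    proof
      fix x assume x: "x \<in> K n"
      \<comment> \<open>This coefficient makes \<open>m n\<close> vanish on
        \<open>x - ?c *\<^sub>R v\<close>; the earlier functionals vanish there because they do on
        \<open>x\<close> and \<open>v\<close>.\<close>
      let ?c = "m n x / m n v"
      have "x - ?c *\<^sub>R v \<in> K (Suc n)"
        using x v lin
        by (auto simp: K_def less_Suc_eq linear_diff linear_scale)
      then have "x - ?c *\<^sub>R v \<in> ?S" by (simp add: span_base)
      moreover have "?c *\<^sub>R v \<in> ?S" by (simp add: span_base span_scale)
      ultimately have "(x - ?c *\<^sub>R v) + ?c *\<^sub>R v \<in> ?S" by (rule span_add)
      then show "x \<in> ?S" by simp
    qed
    moreover have "B \<subseteq> ?S" by (auto intro: span_base)
    ultimately have "span (B \<union> K n) \<subseteq> ?S"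
      by (intro span_minimal) auto
    then have "?S = UNIV" using B(2) by blast
    then show ?thesis using B(1) unfolding K_def
      by (intro exI[of _ "insert v B"]) simp
  qed
qed

text \<open>The common kernel has a finite complement to a spanning set, so a trivial kernel would
  make the whole space finite dimensional.\<close>

lemma infinite_dimensional_common_kernel:
  fixes m :: "nat \<Rightarrow> 'a::real_vector \<Rightarrow> real"
  assumes "infinite_dimensional TYPE('a)" "\<And>k. linear (m k)"
  obtains x where "x \<noteq> 0" "\<And>k. k < n \<Longrightarrow> m k x = 0"
proof -
  obtain B where B: "finite B" "span (B \<union> {x. \<forall>k<n. m k x = 0}) = UNIV"
    using finite_span_with_kernels[of m n, OF assms(2)] by (elim exE conjE)
  have "\<not> {x. \<forall>k<n. m k x = 0} \<subseteq> {0}"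
  proof
    assume "{x. \<forall>k<n. m k x = 0} \<subseteq> {0}"
    then have "span (B \<union> {x. \<forall>k<n. m k x = 0}) \<subseteq> span (insert 0 B)"
      by (intro span_mono) auto
    then have "span (insert 0 B) = UNIV" unfolding B(2) by (rule top.extremum_uniqueI)
    moreover have "finite (insert 0 B)" using B(1) by simp
    ultimately show False
      using assms(1) unfolding infinite_dimensional_def by (metis (no_types))
  qed
  then show thesis using that by blast
qed

section \<open>The scalar function \<open>exp (- 1 / s)\<close>\<close>

lemma exp_neg_recip_0 [simp]: "exp_neg_recip 0 = 0"
  by (simp add: exp_neg_recip_def)

lemma exp_neg_recip_pos: "s \<noteq> 0 \<Longrightarrow> exp_neg_recip s > 0"
  by (simp add: exp_neg_recip_def)

lemma exp_neg_recip_nonneg: "exp_neg_recip s \<ge> 0"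
  by (simp add: exp_neg_recip_def)

lemma exp_neg_recip_mono:
  assumes "0 \<le> s" "s \<le> t"
  shows "exp_neg_recip s \<le> exp_neg_recip t"
  using assms by (auto simp: exp_neg_recip_def frac_le)

lemma exp_neg_recip_has_real_derivative:
  assumes "s > 0"
  shows "(exp_neg_recip has_real_derivative exp_neg_recip s / s\<^sup>2) (at s)"
proof -
  have "((\<lambda>s. exp (- (1 / s))) has_real_derivative exp (- (1 / s)) / s\<^sup>2) (at s)"
    using assms by (auto intro!: derivative_eq_intros simp: power2_eq_square)
  \<comment> \<open>The case distinction in \<open>exp_neg_recip\<close> is invisible on the open
    half-line around \<open>s\<close>, so the derivative carries over.\<close>
  moreover have "\<forall>\<^sub>F t in nhds s. exp (- (1 / t)) = exp_neg_recip t"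
    using assms by (intro eventually_nhds_in_open[of "{0<..}", THEN eventually_mono])
      (auto simp: exp_neg_recip_def)
  ultimately have "(exp_neg_recip has_real_derivative exp (- (1 / s)) / s\<^sup>2) (at s)"
    by (rule DERIV_cong_ev[OF refl _ refl, THEN iffD1, rotated])
  then show ?thesis using assms by (simp add: exp_neg_recip_def)
qed

lemma tendsto_exp_neg_recip_div_power_at_right_0:
  "((\<lambda>s. exp_neg_recip s / s ^ n) \<longlongrightarrow> 0) (at_right 0)"
proof (rule Lim_transform_eventually)
  show "((\<lambda>s::real. exp (- (1 / s)) / s ^ n) \<longlongrightarrow> 0) (at_right 0)"
    by real_asymp
  show "\<forall>\<^sub>F s in at_right (0::real). exp (- (1 / s)) / s ^ n = exp_neg_recip s / s ^ n"
    by (auto simp: eventually_at_filter exp_neg_recip_def)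
qed

text \<open>At \<open>s = 0\<close> the quotient has value 0, which is also its limit from the
  right. From the left \<open>exp (- 1 / s)\<close> blows up, hence the domain \<open>{0..}\<close>.
  The powers 0 and 2 occur in the derivative of the flat map.\<close>

lemma continuous_on_exp_neg_recip_div_power:
  "continuous_on {0..} (\<lambda>s. exp_neg_recip s / s ^ n)"
  unfolding continuous_on_eq_continuous_within
proof
  fix s :: real assume "s \<in> {0..}"
  then consider "s = 0" | "s > 0" by fastforce
  then show "continuous (at s within {0..}) (\<lambda>s. exp_neg_recip s / s ^ n)"
  proof cases
    case 1
    then show ?thesis
      using tendsto_exp_neg_recip_div_power_at_right_0[of n]
      by (simp add: continuous_within at_within_Ici_at_right)
  next
    case 2
    then have "isCont exp_neg_recip s"
      using exp_neg_recip_has_real_derivative DERIV_isCont by blast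
    then have "isCont (\<lambda>s. exp_neg_recip s / s ^ n) s"
      using 2 by (intro continuous_intros) auto
    then show ?thesis by (rule continuous_at_imp_continuous_within)
  qed
qed

section \<open>The symmetric bilinear form behind the weighted square sum\<close>

text \<open>This is the polarization of \<open>weighted_square_sum l\<close>, curried into a map to
  the dual space. Summing functionals rather than values gives boundedness in the second argument at
  once.\<close>

definition weighted_form :: "(nat \<Rightarrow> 'a::real_normed_vector \<Rightarrow>\<^sub>L real) \<Rightarrow> 'a \<Rightarrow> 'a \<Rightarrow>\<^sub>L real" where
  "weighted_form l x = (\<Sum>k. (blinfun_apply (l (Suc k)) x / 2 ^ Suc k) *\<^sub>R l (Suc k))"

lemma sums_half_powers: "(\<lambda>k. c / 2 ^ Suc k) sums (c::real)"
  using sums_mult[OF power_half_series, of c] by (simp add: power_divide)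

locale functionals_in_unit_ball =
  fixes l :: "nat \<Rightarrow> 'a::real_normed_vector \<Rightarrow>\<^sub>L real"
  assumes norm_le: "norm (l (Suc k)) \<le> 1"
begin

lemma functional_le: "\<bar>blinfun_apply (l (Suc k)) x\<bar> \<le> norm x"
proof -
  have "\<bar>blinfun_apply (l (Suc k)) x\<bar> \<le> norm (l (Suc k)) * norm x"
    using norm_blinfun[of "l (Suc k)" x] by simp
  also have "\<dots> \<le> 1 * norm x"
    by (intro mult_right_mono norm_le) simp
  finally show ?thesis by simp
qed

lemma weighted_form_term_le:
  "norm ((blinfun_apply (l (Suc k)) x / 2 ^ Suc k) *\<^sub>R l (Suc k)) \<le> norm x / 2 ^ Suc k"
proof -
  have "\<bar>blinfun_apply (l (Suc k)) x\<bar> * norm (l (Suc k)) \<le> norm x * 1"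
    by (intro mult_mono functional_le norm_le) auto
  then show ?thesis by (simp add: divide_right_mono)
qed

lemma summable_norm_weighted_form:
  "summable (\<lambda>k. norm ((blinfun_apply (l (Suc k)) x / 2 ^ Suc k) *\<^sub>R l (Suc k)))"
  by (rule summable_comparison_test'[OF sums_summable[OF sums_half_powers[of "norm x"]], of 0])
    (use weighted_form_term_le in auto)

text \<open>The dual space is complete because \<open>real\<close> is, so absolute convergence
  suffices.\<close>

lemma summable_weighted_form:
  "summable (\<lambda>k. (blinfun_apply (l (Suc k)) x / 2 ^ Suc k) *\<^sub>R l (Suc k))"
  by (rule summable_norm_cancel[OF summable_norm_weighted_form])

lemma norm_weighted_form_le: "norm (weighted_form l x) \<le> norm x"
proof -
  have "norm (weighted_form l x)
      \<le> (\<Sum>k. norm ((blinfun_apply (l (Suc k)) x / 2 ^ Suc k) *\<^sub>R l (Suc k)))"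
    unfolding weighted_form_def by (rule summable_norm[OF summable_norm_weighted_form])
  also have "\<dots> \<le> (\<Sum>k. norm x / 2 ^ Suc k)"
    by (intro suminf_le weighted_form_term_le summable_norm_weighted_form
        sums_summable[OF sums_half_powers])
  also have "\<dots> = norm x" using sums_half_powers[of "norm x"] by (simp add: sums_iff)
  finally show ?thesis .
qed

lemma bounded_linear_weighted_form: "bounded_linear (weighted_form l)"
proof (rule bounded_linear_intro)
  show "weighted_form l (x + y) = weighted_form l x + weighted_form l y" for x y
    unfolding weighted_form_def
    by (subst suminf_add[OF summable_weighted_form summable_weighted_form])
      (simp add: blinfun.add_right add_divide_distrib scaleR_left_distrib)
  show "weighted_form l (r *\<^sub>R x) = r *\<^sub>R weighted_form l x" for r x
    unfolding weighted_form_def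
    by (subst suminf_scaleR_right[OF summable_weighted_form])
      (simp add: blinfun.scaleR_right)
  show "norm (weighted_form l x) \<le> norm x * 1" for x
    using norm_weighted_form_le by simp
qed

text \<open>Evaluation at \<open>y\<close> is a bounded linear map on the dual space and so passes
  through the series.\<close>

lemma sums_weighted_form_apply:
  "(\<lambda>k. blinfun_apply (l (Suc k)) x * blinfun_apply (l (Suc k)) y / 2 ^ Suc k)
    sums blinfun_apply (weighted_form l x) y"
  using bounded_linear.sums[OF blinfun.bounded_linear_left
      summable_sums[OF summable_weighted_form[of x]], of y]
  by (simp add: weighted_form_def blinfun.scaleR_left)

lemma weighted_form_commute:
  "blinfun_apply (weighted_form l x) y = blinfun_apply (weighted_form l y) x"
  using sums_weighted_form_apply[of x y] sums_weighted_form_apply[of y x]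
  by (simp add: mult.commute sums_unique2)

lemma sums_weighted_square_sum:
  "(\<lambda>k. (blinfun_apply (l (Suc k)) x)\<^sup>2 / 2 ^ Suc k) sums weighted_square_sum l x"
  using sums_summable[OF sums_weighted_form_apply[of x x]]
  by (simp add: weighted_square_sum_def power2_eq_square summable_sums)

lemma weighted_square_sum_eq: "weighted_square_sum l x = blinfun_apply (weighted_form l x) x"
  using sums_weighted_square_sum[of x] sums_weighted_form_apply[of x x]
  by (simp add: power2_eq_square sums_unique2)

lemma weighted_square_sum_nonneg: "0 \<le> weighted_square_sum l x"
  by (rule sums_le[OF _ sums_zero sums_weighted_square_sum]) simp

lemma weighted_square_sum_0 [simp]: "weighted_square_sum l 0 = 0"
  by (simp add: weighted_square_sum_eq)

lemma weighted_square_sum_scaleR: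
  "weighted_square_sum l (c *\<^sub>R x) = c\<^sup>2 * weighted_square_sum l x"
  by (simp add: weighted_square_sum_eq linear_scale[OF bounded_linear.linear[OF bounded_linear_weighted_form]]
      blinfun.scaleR_left blinfun.scaleR_right power2_eq_square)

lemma weighted_square_sum_pos:
  assumes "blinfun_apply (l (Suc k)) x \<noteq> 0"
  shows "weighted_square_sum l x > 0"
proof -
  have "0 < (blinfun_apply (l (Suc k)) x)\<^sup>2 / 2 ^ Suc k" using assms by simp
  then show ?thesis unfolding weighted_square_sum_def
    by (intro suminf_pos2[OF sums_summable[OF sums_weighted_square_sum], of _ k]) auto
qed

text \<open>Only the terms from index \<open>n\<close> on survive, and their weights
  \<open>1 / 2 ^ Suc (k + n)\<close> add up to \<open>1 / 2 ^ n\<close>.\<close>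

lemma weighted_square_sum_le_tail:
  assumes "\<And>k. k < n \<Longrightarrow> blinfun_apply (l (Suc k)) x = 0"
  shows "weighted_square_sum l x \<le> (norm x)\<^sup>2 / 2 ^ n"
proof -
  let ?f = "\<lambda>k. (blinfun_apply (l (Suc k)) x)\<^sup>2 / 2 ^ Suc k"
  have "(\<lambda>k. ?f (k + n)) sums weighted_square_sum l x"
    using sums_split_initial_segment[OF sums_weighted_square_sum[of x], of n] assms by simp
  moreover have "(\<lambda>k. (norm x)\<^sup>2 / 2 ^ n / 2 ^ Suc k) sums ((norm x)\<^sup>2 / 2 ^ n)"
    by (rule sums_half_powers)
  moreover have "?f (k + n) \<le> (norm x)\<^sup>2 / 2 ^ n / 2 ^ Suc k" for k
  proof -
    have "(blinfun_apply (l (Suc (k + n))) x)\<^sup>2 \<le> (norm x)\<^sup>2"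
      using functional_le by (simp add: abs_le_square_iff[symmetric])
    then show ?thesis by (simp add: power_add divide_right_mono mult.commute mult.left_commute)
  qed
  ultimately show ?thesis by (metis (no_types, lifting) sums_le)
qed

text \<open>The product rule for evaluation gives two terms, which symmetry of the form makes
  equal.\<close>

lemma weighted_square_sum_has_derivative:
  "(weighted_square_sum l has_derivative (\<lambda>h. 2 * blinfun_apply (weighted_form l x) h)) (at x)"
proof -
  have "((\<lambda>x. blinfun_apply (weighted_form l x) x) has_derivative
      (\<lambda>h. blinfun_apply (weighted_form l x) h + blinfun_apply (weighted_form l h) x)) (at x)"
    by (intro blinfun.FDERIV bounded_linear_imp_has_derivative bounded_linear_weighted_form
        has_derivative_ident)
  then show ?thesis
    by (simp add: weighted_form_commute[of _ x] weighted_square_sum_eq[abs_def])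
qed

lemma continuous_on_weighted_square_sum: "continuous_on S (weighted_square_sum l)"
  by (intro continuous_at_imp_continuous_on ballI
      has_derivative_continuous[OF weighted_square_sum_has_derivative])

lemma continuous_on_exp_neg_recip_weighted_square_sum:
  "continuous_on S (\<lambda>x. exp_neg_recip (weighted_square_sum l x) / weighted_square_sum l x ^ n)"
  by (rule continuous_on_compose2[OF continuous_on_exp_neg_recip_div_power
        continuous_on_weighted_square_sum])
    (auto simp: weighted_square_sum_nonneg)

end

text \<open>At a point where the weighted square sum vanishes, the quotient is \<open>0 / 0 = 0\<close>, so this is
  also the derivative at the origin.\<close>

definition flat_map_deriv ::
    "(nat \<Rightarrow> 'a::real_normed_vector \<Rightarrow>\<^sub>L real) \<Rightarrow> 'a \<Rightarrow> 'a \<Rightarrow>\<^sub>L 'a" where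
  "flat_map_deriv l x = exp_neg_recip (weighted_square_sum l x) *\<^sub>R id_blinfun
    + (2 * (exp_neg_recip (weighted_square_sum l x) / (weighted_square_sum l x)\<^sup>2)) *\<^sub>R
        (blinfun_scaleR_left x o\<^sub>L weighted_form l x)"

lemma flat_map_deriv_apply:
  "blinfun_apply (flat_map_deriv l x) h = exp_neg_recip (weighted_square_sum l x) *\<^sub>R h
    + (2 * (exp_neg_recip (weighted_square_sum l x) / (weighted_square_sum l x)\<^sup>2)
        * blinfun_apply (weighted_form l x) h) *\<^sub>R x"
  by (simp add: flat_map_deriv_def blinfun.add_left blinfun.scaleR_left)

section \<open>Invertibility of operators\<close>

lemma has_bounded_inverse_scaleR_id_plus_rank_one:
  fixes f :: "'a::real_normed_vector \<Rightarrow>\<^sub>L real"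
  assumes "a \<noteq> 0" "a + blinfun_apply f v \<noteq> 0"
    and A: "\<And>h. blinfun_apply A h = a *\<^sub>R h + blinfun_apply f h *\<^sub>R v"
  shows "has_bounded_inverse A"
proof -
  define d where "d = a + blinfun_apply f v"
  have d: "d \<noteq> 0" "blinfun_apply f v = d - a" using assms(2) by (auto simp: d_def)
  \<comment> \<open>Applying \<open>f\<close> to \<open>A h = y\<close> gives
    \<open>f y = d * f h\<close>; substituting \<open>f h = f y / d\<close> and solving for
    \<open>h\<close> yields this Sherman--Morrison inverse.\<close>
  define B where "B = (1 / a) *\<^sub>R id_blinfun - (1 / (a * d)) *\<^sub>R (blinfun_scaleR_left v o\<^sub>L f)"
  have B: "blinfun_apply B h = (1 / a) *\<^sub>R h - (blinfun_apply f h / (a * d)) *\<^sub>R v" for h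
    by (simp add: B_def blinfun.diff_left blinfun.scaleR_left)
  have "blinfun_apply B (blinfun_apply A h) = h" for h
  proof -
    have "blinfun_apply f (blinfun_apply A h) = blinfun_apply f h * d"
      by (simp add: A blinfun.add_right blinfun.scaleR_right d(2) algebra_simps)
    then have "blinfun_apply B (blinfun_apply A h)
        = (1 / a) *\<^sub>R blinfun_apply A h - (blinfun_apply f h * d / (a * d)) *\<^sub>R v"
      by (simp only: B)
    also have "\<dots> = h" using assms(1) d(1) by (simp add: A scaleR_add_right)
    finally show ?thesis .
  qed
  moreover have "blinfun_apply A (blinfun_apply B h) = h" for h
  proof -
    have "blinfun_apply f (blinfun_apply B h) = blinfun_apply f h / d"
      using assms(1) d(1)
      by (simp add: B blinfun.diff_right blinfun.scaleR_right d(2) field_simps)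
    then have "blinfun_apply A (blinfun_apply B h)
        = a *\<^sub>R blinfun_apply B h + (blinfun_apply f h / d) *\<^sub>R v"
      by (simp only: A)
    also have "\<dots> = h" using assms(1) by (simp add: B scaleR_diff_right)
    finally show ?thesis .
  qed
  ultimately show ?thesis
    unfolding has_bounded_inverse_def
    by (intro exI[of _ B] conjI blinfun_eqI) simp_all
qed

text \<open>The vector \<open>x\<close> excludes the zero space, on which the zero operator is the
  identity.\<close>

lemma not_has_bounded_inverse_0:
  assumes "(x::'a::real_normed_vector) \<noteq> 0"
  shows "\<not> has_bounded_inverse (0 :: 'a \<Rightarrow>\<^sub>L 'b::real_normed_vector)"
proof
  assume "has_bounded_inverse (0 :: 'a \<Rightarrow>\<^sub>L 'b)"
  then obtain B :: "'b \<Rightarrow>\<^sub>L 'a" where "B o\<^sub>L 0 = id_blinfun"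
    unfolding has_bounded_inverse_def by blast
  then have "x = blinfun_apply (B o\<^sub>L 0) x" by (simp only: blinfun_apply_id_blinfun)
  with assms show False by simp
qed

section \<open>Differentiability and critical points of the flat map\<close>

locale separating_functionals = functionals_in_unit_ball l
  for l :: "nat \<Rightarrow> 'a::real_normed_vector \<Rightarrow>\<^sub>L real" +
  assumes separating: "\<And>x. (\<And>k. blinfun_apply (l (Suc k)) x = 0) \<Longrightarrow> x = 0"
begin

lemma weighted_square_sum_pos_iff: "weighted_square_sum l x > 0 \<longleftrightarrow> x \<noteq> 0"
  using weighted_square_sum_pos separating by (metis less_irrefl weighted_square_sum_0)

lemma flat_map_has_derivative:
  "(flat_map l has_derivative blinfun_apply (flat_map_deriv l x)) (at x)"
proof (cases "x = 0")
  case True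
  have "isCont (\<lambda>x. exp_neg_recip (weighted_square_sum l x)) 0"
    using continuous_on_exp_neg_recip_weighted_square_sum[where S = UNIV and n = 0]
    by (simp add: continuous_on_eq_continuous_at)
  then have "((\<lambda>x. exp_neg_recip (weighted_square_sum l x)) \<longlongrightarrow> 0) (at 0)"
    by (simp add: isCont_def)
  \<comment> \<open>For nonzero \<open>h\<close> this quotient is exactly the scalar factor
    \<open>exp_neg_recip (weighted_square_sum l h)\<close>.\<close>
  then have "((\<lambda>h. norm (flat_map l h) / norm h) \<longlongrightarrow> 0) (at 0)"
    by (rule Lim_transform_eventually)
      (auto simp: eventually_at_filter flat_map_def exp_neg_recip_nonneg)
  moreover have "blinfun_apply (flat_map_deriv l 0) = (\<lambda>h. 0)"
    by (auto simp: flat_map_deriv_apply)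
  ultimately show ?thesis
    using True by (simp add: has_derivative_at flat_map_def)
next
  case False
  then have pos: "weighted_square_sum l x > 0" by (simp add: weighted_square_sum_pos_iff)
  have "((\<lambda>x. exp_neg_recip (weighted_square_sum l x)) has_derivative
      (\<lambda>h. exp_neg_recip (weighted_square_sum l x) / (weighted_square_sum l x)\<^sup>2
        * (2 * blinfun_apply (weighted_form l x) h))) (at x)"
    using has_derivative_compose[OF weighted_square_sum_has_derivative
        exp_neg_recip_has_real_derivative[OF pos, unfolded has_field_derivative_def]] .
  from has_derivative_scaleR[OF this has_derivative_ident]
  show ?thesis
    by (simp add: flat_map_def[abs_def] flat_map_deriv_apply[abs_def] mult_ac)
qed

text \<open>Flatness makes both scalar coefficients continuous through the origin, and the rank-one
  operator depends continuously on \<open>x\<close> in operator norm.\<close>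

lemma continuous_on_flat_map_deriv: "continuous_on UNIV (flat_map_deriv l)"
proof -
  have "continuous_on UNIV (\<lambda>x. exp_neg_recip (weighted_square_sum l x))"
    using continuous_on_exp_neg_recip_weighted_square_sum[where n = 0] by simp
  moreover have "continuous_on UNIV (\<lambda>x. blinfun_scaleR_left x o\<^sub>L weighted_form l x)"
    by (intro bounded_bilinear.continuous_on[OF bounded_bilinear_blinfun_compose]
        bounded_linear.continuous_on[OF bounded_linear_weighted_form]
        bounded_linear.continuous_on[OF bounded_linear_blinfun_scaleR_left] continuous_on_id)
  ultimately show ?thesis
    unfolding flat_map_deriv_def[abs_def]
    by (intro continuous_on_add continuous_on_scaleR continuous_on_mult continuous_on_const
        continuous_on_exp_neg_recip_weighted_square_sum)
qed

lemma has_bounded_inverse_flat_map_deriv: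
  assumes "x \<noteq> 0"
  shows "has_bounded_inverse (flat_map_deriv l x)"
proof -
  define s where "s = weighted_square_sum l x"
  have s: "s > 0" using assms by (simp add: s_def weighted_square_sum_pos_iff)
  define a where "a = exp_neg_recip s"
  have a: "a > 0" using s by (simp add: a_def exp_neg_recip_pos)
  define f where "f = (2 * (a / s\<^sup>2)) *\<^sub>R weighted_form l x"
  \<comment> \<open>By Euler's identity \<open>weighted_form l x\<close> takes the value
    \<open>s\<close> at \<open>x\<close>, so \<open>f x = 2 * a / s\<close> and
    \<open>a + f x\<close> is positive.\<close>
  have "blinfun_apply f x \<ge> 0"
    using a s by (simp add: f_def blinfun.scaleR_left s_def weighted_square_sum_eq)
  then show ?thesis
    using a
    by (intro has_bounded_inverse_scaleR_id_plus_rank_one[of a f x])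
      (auto simp: flat_map_deriv_apply f_def a_def s_def blinfun.scaleR_left)
qed

lemma critical_point_flat_map_iff:
  assumes "\<exists>v::'a. v \<noteq> 0"
  shows "critical_point (flat_map l) x \<longleftrightarrow> x = 0"
proof (cases "x = 0")
  case True
  have "\<not> regular_point (flat_map l) 0"
  proof
    assume "regular_point (flat_map l) 0"
    then obtain A where A: "(flat_map l has_derivative blinfun_apply A) (at 0)"
      "has_bounded_inverse A" unfolding regular_point_def by blast
    \<comment> \<open>Regularity only asserts some invertible derivative; uniqueness identifies it
      with the zero operator.\<close>
    then have "blinfun_apply A = blinfun_apply (flat_map_deriv l 0)"
      using flat_map_has_derivative has_derivative_unique by blast
    then have "A = 0"
      by (intro blinfun_eqI) (simp add: flat_map_deriv_apply)
    then show False using A(2) not_has_bounded_inverse_0 assms by blast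
  qed
  then show ?thesis
    using True flat_map_has_derivative unfolding critical_point_def differentiable_def by blast
next
  case False
  then show ?thesis
    using flat_map_has_derivative has_bounded_inverse_flat_map_deriv
    unfolding critical_point_def regular_point_def by blast
qed

section \<open>Failure of openness at the origin\<close>

text \<open>A preimage \<open>x\<close> of \<open>c *\<^sub>R e\<close> lies on the same ray,
  \<open>x = t *\<^sub>R e\<close> with \<open>0 < t < 1\<close>. Its scalar factor
  \<open>a = c / t\<close> therefore exceeds \<open>c\<close>, while quadratic scaling bounds it by
  the factor at \<open>e\<close>.\<close>

lemma flat_map_on_ray_le:
  assumes e: "norm e = 1" and c: "c > 0" and x: "norm x < 1" and eq: "flat_map l x = c *\<^sub>R e"
  shows "c \<le> exp_neg_recip (weighted_square_sum l e)"
proof -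
  define a where "a = exp_neg_recip (weighted_square_sum l x)"
  have ax: "a *\<^sub>R x = c *\<^sub>R e" using eq by (simp add: flat_map_def a_def)
  have "a \<ge> 0" by (simp add: a_def exp_neg_recip_nonneg)
  moreover have "a \<noteq> 0" using ax c e by auto
  ultimately have a: "a > 0" by simp
  define t where "t = c / a"
  have "(1 / a) *\<^sub>R (a *\<^sub>R x) = (1 / a) *\<^sub>R (c *\<^sub>R e)" by (simp only: ax)
  then have xe: "x = t *\<^sub>R e" using a by (simp add: t_def)
  have t: "t > 0" using a c by (simp add: t_def)
  then have t1: "t < 1" using x e xe by simp
  have "weighted_square_sum l x \<le> weighted_square_sum l e"
    using t t1 by (simp add: xe weighted_square_sum_scaleR
        mult_left_le_one_le weighted_square_sum_nonneg power_le_one)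
  then have "a \<le> exp_neg_recip (weighted_square_sum l e)"
    by (simp add: a_def exp_neg_recip_mono weighted_square_sum_nonneg)
  moreover have "c \<le> a" using t1 a by (simp add: t_def)
  ultimately show ?thesis by simp
qed

lemma exists_unit_vector_weighted_square_sum_le:
  assumes "infinite_dimensional TYPE('a)"
  obtains e where "norm e = 1" "weighted_square_sum l e \<le> 1 / 2 ^ n"
proof -
  obtain x where x: "x \<noteq> 0" "\<And>k. k < n \<Longrightarrow> blinfun_apply (l (Suc k)) x = 0"
    using infinite_dimensional_common_kernel[OF assms, of "\<lambda>k. blinfun_apply (l (Suc k))" n]
      blinfun.bounded_linear_right bounded_linear.linear by blast
  have "norm (sgn x) = 1" using x(1) by (simp add: norm_sgn)
  moreover from this have "weighted_square_sum l (sgn x) \<le> 1 / 2 ^ n"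
    using weighted_square_sum_le_tail[of n "sgn x"] x(2)
    by (simp add: sgn_div_norm blinfun.scaleR_right)
  ultimately show thesis by (rule that)
qed

lemma not_open_map_flat_map:
  assumes "infinite_dimensional TYPE('a)"
  shows "\<not> open_map euclidean euclidean (flat_map l)"
proof
  assume "open_map euclidean euclidean (flat_map l)"
  then have "open (flat_map l ` ball 0 1)"
    unfolding open_map_def by simp
  moreover have "0 \<in> flat_map l ` ball 0 1"
    by (rule image_eqI[of _ _ 0]) (simp_all add: flat_map_def)
  ultimately obtain r where r: "r > 0" "ball 0 r \<subseteq> flat_map l ` ball 0 1"
    using open_contains_ball by blast
  have bound: "r / 2 \<le> exp_neg_recip (1 / 2 ^ n)" for n
  proof -
    obtain e where e: "norm e = 1" "weighted_square_sum l e \<le> 1 / 2 ^ n"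
      using exists_unit_vector_weighted_square_sum_le[OF assms] by blast
    \<comment> \<open>The radius \<open>r / 2\<close> does not depend on \<open>n\<close>, whereas
      \<open>e\<close> does; letting \<open>n\<close> grow then forces \<open>r / 2\<close> to be at
      most 0.\<close>
    have "(r / 2) *\<^sub>R e \<in> ball 0 r" using r(1) e(1) by simp
    with r(2) have "(r / 2) *\<^sub>R e \<in> flat_map l ` ball 0 1" by (rule subsetD)
    then obtain x where x: "norm x < 1" "flat_map l x = (r / 2) *\<^sub>R e"
      by (auto elim!: imageE)
    have "r / 2 \<le> exp_neg_recip (weighted_square_sum l e)"
      using r(1) by (intro flat_map_on_ray_le[OF e(1) _ x]) simp
    also have "\<dots> \<le> exp_neg_recip (1 / 2 ^ n)"
      by (intro exp_neg_recip_mono weighted_square_sum_nonneg e(2))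
    finally show ?thesis .
  qed
  have "(\<lambda>n. exp_neg_recip (1 / 2 ^ n)) = (\<lambda>n. exp (- (2 ^ n)))"
    by (auto simp: exp_neg_recip_def)
  moreover have "(\<lambda>n. exp (- (2 ^ n)) :: real) \<longlonglongrightarrow> 0"
    by real_asymp
  ultimately have "(\<lambda>n. exp_neg_recip (1 / 2 ^ n)) \<longlonglongrightarrow> 0" by simp
  then have "r / 2 \<le> 0" using bound by (intro LIMSEQ_le_const) auto
  with r(1) show False by simp
qed

end

theorem theorem7p9:
  fixes l :: "nat \<Rightarrow> 'a::banach \<Rightarrow>\<^sub>L real"
  assumes "infinite_dimensional TYPE('a)"
    and "\<forall>k\<ge>1. norm (l k) = 1"
    and "\<forall>x. x = 0 \<longleftrightarrow> (\<forall>k\<ge>1. blinfun_apply (l k) x = 0)"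
  shows "\<not> open_map euclidean euclidean (flat_map l)
    \<and> C1_map (flat_map l)
    \<and> (\<forall>x. critical_point (flat_map l) x \<longleftrightarrow> x = 0)"
proof -
  interpret separating_functionals l
  proof
    show "norm (l (Suc k)) \<le> 1" for k
      using assms(2) by simp
    show "x = 0" if "\<And>k. blinfun_apply (l (Suc k)) x = 0" for x
      \<comment> \<open>Every index \<open>k \<ge> 1\<close> is a successor, which matches the
        shifted indexing of the locale.\<close>
      using assms(3) that by (metis One_nat_def Suc_le_D)
  qed
  have "\<exists>v::'a. v \<noteq> 0"
    \<comment> \<open>With \<open>n = 0\<close> no kernel condition is imposed, so this merely
      supplies a nonzero vector.\<close>
    using infinite_dimensional_common_kernel[OF assms(1), of "\<lambda>_ _. 0" 0]
    by (metis linear_zero)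
  then show ?thesis
    using not_open_map_flat_map[OF assms(1)]
      critical_point_flat_map_iff
      flat_map_has_derivative
      continuous_on_flat_map_deriv
    unfolding C1_map_def by blast
qed

end
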